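(* Let $X$ be a Banach space and let $Y \subset X$ be an $M$-ideal in $X$. If $X$ has $BSCSP$, then $Y$ has $BSCSP$.
   Context: All Banach spaces (including the subspace $Y$) are real and nontrivial ($\neq \{0\}$). $B_X$ is the closed unit ball of $X$. $M$-ideal: for a closed subspace $Y \subset X$ let $Y^\perp = \{x^* \in X^* : x^*(y) = 0 \ \forall y \in Y\}$. A linear projection $P$ on a Banach space $Z$ is an $L$-projection if $\|z\| = \|Pz\| + \|z - Pz\|$ for all $z \in Z$. A closed subspace $Y \subset X$ is an $M$-ideal in $X$ if there is an $L$-projection $P : X^* \to X^*$ with $\ker P = Y^\perp$. Slices: for $f \in X^*$ with $\|f\| = 1$ and $\alpha > 0$, the set $S(B_X,f,\alpha) = \{x \in B_X : f(x) > \sup f(B_X) - \alpha\}$ is an open slice of $B_X$. A convex combination of slices of $B_X$ is a set $\sum_{i=1}^n \lambda_i S_i = \{\sum_{i=1}^n \lambda_i x_i : x_i \in S_i\}$ with $n \in \mathbb{N}$, each $S_i$ a slice of $B_X$, $\lambda_i > 0$, $\sum_{i=1}^n \lambda_i = 1$. A Banach space $X$ has $BSCSP$ (ball small combination of slices property) if for every $\varepsilon > 0$ there is a convex combination of slices of $B_X$ with (norm) diameter less than $\varepsilon$. *)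

theory Defs
  imports "HOL-Analysis.Analysis"
begin

text \<open>A Banach space is either a whole type of class \<^class>\<open>banach\<close> or a closed subspace
  \<open>Y\<close> of one, given as a set with the norm of the ambient type. Notions needed for both are
  relative to a carrier \<open>Y\<close>; the whole space is the carrier \<open>UNIV\<close>.\<close>

definition unit_ball_of :: "'a::real_normed_vector set \<Rightarrow> 'a set" where
  "unit_ball_of Y = {x \<in> Y. norm x \<le> 1}"

text \<open>A functional on \<open>Y\<close> is represented by a total function of which only the values on \<open>Y\<close>
  matter; no extension to a functional on the ambient space is presupposed.\<close>

definition dual_on :: "'a::real_normed_vector set \<Rightarrow> ('a \<Rightarrow> real) set" where
  "dual_on Y = {f. (\<forall>x\<in>Y. \<forall>y\<in>Y. f (x + y) = f x + f y)
                 \<and> (\<forall>c. \<forall>x\<in>Y. f (c *\<^sub>R x) = c * f x)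
                 \<and> (\<exists>K. \<forall>x\<in>Y. \<bar>f x\<bar> \<le> K * norm x)}"

definition dual_norm_on :: "'a::real_normed_vector set \<Rightarrow> ('a \<Rightarrow> real) \<Rightarrow> real" where
  "dual_norm_on Y f = (SUP x\<in>unit_ball_of Y. \<bar>f x\<bar>)"

definition slice :: "'a::real_normed_vector set \<Rightarrow> ('a \<Rightarrow> real) \<Rightarrow> real \<Rightarrow> 'a set" where
  "slice Y f \<alpha> = {x \<in> unit_ball_of Y. f x > Sup (f ` unit_ball_of Y) - \<alpha>}"

definition is_slice :: "'a::real_normed_vector set \<Rightarrow> 'a set \<Rightarrow> bool" where
  "is_slice Y S \<longleftrightarrow> (\<exists>f \<alpha>. f \<in> dual_on Y \<and> dual_norm_on Y f = 1 \<and> \<alpha> > 0 \<and> S = slice Y f \<alpha>)"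

definition is_convex_combination_of_slices :: "'a::real_normed_vector set \<Rightarrow> 'a set \<Rightarrow> bool" where
  "is_convex_combination_of_slices Y C \<longleftrightarrow>
     (\<exists>(n::nat) (w::nat \<Rightarrow> real) S.
        (\<forall>i<n. is_slice Y (S i)) \<and> (\<forall>i<n. w i > 0) \<and> (\<Sum>i<n. w i) = 1 \<and>
        C = {(\<Sum>i<n. w i *\<^sub>R x i) | x. \<forall>i<n. x i \<in> S i})"

definition BSCSP :: "'a::real_normed_vector set \<Rightarrow> bool" where
  "BSCSP Y \<longleftrightarrow> (\<forall>\<epsilon>>0. \<exists>C. is_convex_combination_of_slices Y C \<and> diameter C < \<epsilon>)"

definition annihilator :: "'a::real_normed_vector set \<Rightarrow> ('a \<Rightarrow>\<^sub>L real) set" where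
  "annihilator Y = {f. \<forall>y\<in>Y. blinfun_apply f y = 0}"

definition L_projection :: "('z::real_normed_vector \<Rightarrow> 'z) \<Rightarrow> bool" where
  "L_projection P \<longleftrightarrow> linear P \<and> (\<forall>z. P (P z) = P z) \<and> (\<forall>z. norm z = norm (P z) + norm (z - P z))"

definition M_ideal :: "'a::banach set \<Rightarrow> bool" where
  "M_ideal Y \<longleftrightarrow> subspace Y \<and> closed Y \<and>
     (\<exists>P :: ('a \<Rightarrow>\<^sub>L real) \<Rightarrow> ('a \<Rightarrow>\<^sub>L real). L_projection P \<and> {f. P f = 0} = annihilator Y)"

text \<open>On the whole space the relative dual and dual norm are the library's.\<close>

lemma dual_on_UNIV: "dual_on (UNIV :: 'a::real_normed_vector set) = {f. bounded_linear f}"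
  by (auto simp: dual_on_def bounded_linear_def bounded_linear_axioms_def linear_iff mult.commute)

lemma dual_norm_on_UNIV:
  fixes f :: "'a::real_normed_vector \<Rightarrow> real"
  assumes "bounded_linear f"
  shows "dual_norm_on UNIV f = onorm f"
proof -
  interpret bounded_linear f by fact
  have le: "\<bar>f x\<bar> \<le> onorm f" if "norm x \<le> 1" for x
  proof -
    have "\<bar>f x\<bar> \<le> onorm f * norm x"
      using onorm[OF assms, of x] by simp
    also have "\<dots> \<le> onorm f"
      using that onorm_pos_le[OF assms] by (simp add: mult_left_le)
    finally show ?thesis .
  qed
  have bdd: "bdd_above ((\<lambda>x. \<bar>f x\<bar>) ` unit_ball_of UNIV)"
    using le by (auto simp: bdd_above_def unit_ball_of_def)
  have "\<bar>f x\<bar> \<le> dual_norm_on UNIV f" if "norm x \<le> 1" for x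
    unfolding dual_norm_on_def using that by (intro cSUP_upper bdd) (simp add: unit_ball_of_def)
  note ge = this
  have "onorm f \<le> dual_norm_on UNIV f"
    unfolding onorm_def
  proof (rule cSUP_least)
    fix x :: 'a
    have "norm (x /\<^sub>R norm x) \<le> 1" by (cases "x = 0") auto
    from ge[OF this] show "norm (f x) / norm x \<le> dual_norm_on UNIV f"
      by (simp add: scaleR abs_mult divide_inverse mult.commute)
  qed simp
  moreover have "dual_norm_on UNIV f \<le> onorm f"
    unfolding dual_norm_on_def
    using le by (intro cSUP_least) (auto simp: unit_ball_of_def intro: exI[of _ 0])
  ultimately show ?thesis by simp
qed

end

theory Submission
  imports Defs
begin

text \<open>
  Let \<open>P\<close> be the \<open>L\<close>-projection on the dual of the ambient space \<open>X\<close> with kernel the annihilator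
  of \<open>Y\<close>. A functional \<open>f\<close> with \<open>norm f = 1\<close> splits as \<open>f = g + h\<close> with \<open>g = P f\<close>, with \<open>h\<close>
  vanishing on \<open>Y\<close>, and with \<open>norm g + norm h = 1\<close>. The restriction of \<open>g\<close> to \<open>Y\<close> still has norm
  \<open>norm g\<close> (\<open>norm_le_of_restriction\<close>), so for \<open>g \<noteq> 0\<close> the normalised \<open>g\<close> defines slices of the
  ball of \<open>Y\<close>.

  Each slice \<open>S\<close> of the ball of \<open>X\<close> given by \<open>f\<close> has an associated slice \<open>T\<close> of the ball of \<open>Y\<close>
  whose differences \<open>y - y'\<close> are, up to a small error, differences of two elements of \<open>S\<close>
  (\<open>M_ideal_slice_lift\<close>). Take \<open>T\<close> where \<open>g\<close> is almost \<open>norm g\<close> (any slice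
  if \<open>g = 0\<close>), and pick \<open>x\<close> in the ball of
  \<open>X\<close> with \<open>h x\<close> almost \<open>norm h\<close>. Given \<open>y\<close> and \<open>y'\<close> in \<open>T\<close>, the three-ball property of
  \<open>M\<close>-ideals (\<open>three_ball_property\<close>) yields one \<open>z\<close> in \<open>Y\<close> such that, with \<open>v = x - z\<close>, the
  vectors \<open>v + y\<close>, \<open>v + y'\<close> and \<open>v - y\<close> all have norm at most \<open>1 + \<delta>\<close>. The third bound, tested
  against \<open>h - g\<close>, whose norm is at most 1, shows that \<open>g v\<close> is at worst slightly negative. As
  \<open>h v = h x\<close>, the values \<open>f (v + y)\<close> and \<open>f (v + y')\<close> are almost 1. So both vectors lie in \<open>S\<close>
  after division by \<open>1 + \<delta>\<close>, and \<open>v\<close> cancels from their difference. That the same \<open>z\<close> serves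
  \<open>y\<close> and \<open>y'\<close> is the point at which the full three-ball property enters.

  Forming convex combinations with the same weights, a combination of slices of the ball of \<open>X\<close>
  of diameter \<open>d\<close> gives a combination of slices of the ball of \<open>Y\<close> whose diameter exceeds \<open>d\<close> by
  an arbitrarily small amount at most.

  The norm of \<open>g\<close> on \<open>Y\<close>, the existence of norming functionals and the three-ball property all rest
  on the Hahn--Banach theorem, in the form \<open>hahn_banach_cone\<close>.
\<close>

section \<open>The Hahn--Banach theorem for convex cones\<close>

definition sublinear :: "('a::real_vector \<Rightarrow> real) \<Rightarrow> bool" where
  "sublinear p \<longleftrightarrow> (\<forall>x y. p (x + y) \<le> p x + p y) \<and> (\<forall>c\<ge>0. \<forall>x. p (c *\<^sub>R x) = c * p x)"

lemma sublinear_add: "sublinear p \<Longrightarrow> p (x + y) \<le> p x + p y"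
  and sublinear_scale: "sublinear p \<Longrightarrow> 0 \<le> c \<Longrightarrow> p (c *\<^sub>R x) = c * p x"
  by (auto simp: sublinear_def)

lemma sublinear_zero: "sublinear p \<Longrightarrow> p 0 = 0"
  using sublinear_scale[of p 0 0] by simp

lemma sublinear_minus: "sublinear p \<Longrightarrow> - p (- x) \<le> p x"
  using sublinear_add[of p x "- x"] sublinear_zero[of p] by simp

lemma sublinear_norm: "0 \<le> r \<Longrightarrow> sublinear (\<lambda>x. r * norm x)"
  using mult_left_mono[OF norm_triangle_ineq] by (fastforce simp: sublinear_def distrib_left)

lemma sublinearI:
  assumes add: "\<And>x y. p (x + y) \<le> p x + p y"
    and zero: "p 0 = 0"
    and scale: "\<And>c x. 0 < c \<Longrightarrow> p (c *\<^sub>R x) \<le> c * p x"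
  shows "sublinear p"
proof -
  have "p (c *\<^sub>R x) = c * p x" if "0 \<le> c" for c x
  proof (cases "c = 0")
    case False
    with that have "0 < c" by simp
    then have "p x \<le> inverse c * p (c *\<^sub>R x)"
      using scale[of "inverse c" "c *\<^sub>R x"] by simp
    with \<open>0 < c\<close> have "c * p x \<le> p (c *\<^sub>R x)"
      by (simp add: field_simps)
    with scale[OF \<open>0 < c\<close>, of x] show ?thesis by simp
  qed (simp add: zero)
  with add show ?thesis by (simp add: sublinear_def)
qed

text \<open>The set \<open>G\<close> collects constraints \<open>r \<le> F k\<close> on a linear \<open>F\<close> below \<open>p\<close>. They become upper
  bounds at \<open>- k\<close>, and the infimal convolution of \<open>p\<close> with them absorbs them into a smaller
  sublinear functional; \<open>r \<le> p k\<close> keeps the infimum finite.\<close>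

lemma sublinear_below_cone:
  fixes p :: "'a::real_vector \<Rightarrow> real"
  assumes p: "sublinear p"
    and G: "convex_cone G"
    and le: "\<And>k r. (k, r) \<in> G \<Longrightarrow> r \<le> p k"
  shows "\<exists>q. sublinear q \<and> (\<forall>x. q x \<le> p x) \<and> (\<forall>(k, r)\<in>G. q (- k) \<le> - r)"
proof -
  define q where "q x = (INF (k, r)\<in>G. p (x + k) - r)" for x
  have zero: "(0, 0) \<in> G"
    using convex_cone_contains_0[OF G] by (simp add: zero_prod_def)
  have low: "- p (- x) \<le> p (x + k) - r" if "(k, r) \<in> G" for x k r
    using le[OF that] sublinear_add[OF p, of "x + k" "- x"] by simp
  then have bdd: "bdd_below ((\<lambda>(k, r). p (x + k) - r) ` G)" for x
    by (intro bdd_belowI2[where m = "- p (- x)"]) auto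
  have upper: "q x \<le> p (x + k) - r" if "(k, r) \<in> G" for x k r
    unfolding q_def using cINF_lower[OF bdd that] by simp
  have greatest: "m \<le> q x" if "\<And>k r. (k, r) \<in> G \<Longrightarrow> m \<le> p (x + k) - r" for m x
    unfolding q_def using zero that by (intro cINF_greatest) auto
  have "sublinear q"
  proof (rule sublinearI)
    fix x y
    have "q (x + y) - (p (y + l) - s) \<le> p (x + k) - r"
      if "(k, r) \<in> G" "(l, s) \<in> G" for k r l s
    proof -
      have "(k + l, r + s) \<in> G"
        using convex_cone_add[OF G that] by simp
      from upper[OF this, of "x + y"] sublinear_add[OF p, of "x + k" "y + l"]
      show ?thesis by (simp add: algebra_simps)
    qed
    then have "q (x + y) - (p (y + l) - s) \<le> q x" if "(l, s) \<in> G" for l s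
      using that by (intro greatest)
    then have "q (x + y) - q x \<le> p (y + l) - s" if "(l, s) \<in> G" for l s
      using that by (simp add: algebra_simps)
    then have "q (x + y) - q x \<le> q y" by (intro greatest)
    then show "q (x + y) \<le> q x + q y" by simp
  next
    show "q 0 = 0"
      using upper[OF zero, of 0] greatest[of 0 0] le sublinear_zero[OF p] by fastforce
  next
    fix c :: real and x
    assume "0 < c"
    have "q (c *\<^sub>R x) / c \<le> p (x + k) - r" if "(k, r) \<in> G" for k r
    proof -
      have "(c *\<^sub>R k, c * r) \<in> G"
        using convex_cone_scaleR[OF G _ that, of c] \<open>0 < c\<close> by simp
      from upper[OF this, of "c *\<^sub>R x"] sublinear_scale[OF p, of c "x + k"] \<open>0 < c\<close>
      show ?thesis by (simp add: field_simps)
    qed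
    then have "q (c *\<^sub>R x) / c \<le> q x" by (rule greatest)
    with \<open>0 < c\<close> show "q (c *\<^sub>R x) \<le> c * q x" by (simp add: field_simps)
  qed
  moreover have "q x \<le> p x" for x
    using upper[OF zero, of x] by simp
  moreover have "q (- k) \<le> - r" if "(k, r) \<in> G" for k r
    using upper[OF that, of "- k"] sublinear_zero[OF p] by simp
  ultimately show ?thesis by blast
qed

lemma convex_cone_ray: "convex_cone ((\<lambda>t. t *\<^sub>R a) ` {0..})"
  by (auto simp: convex_cone_iff image_iff simp flip: scaleR_left.add)

text \<open>By Zorn's lemma there is a minimal sublinear functional \<open>m\<close> below \<open>p\<close>. Minimality forces it to
  be odd, hence linear: absorbing the single constraint \<open>m x \<le> F x\<close> into \<open>m\<close> cannot change it.\<close>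

lemma linear_below_sublinear:
  fixes p :: "'a::real_vector \<Rightarrow> real"
  assumes p: "sublinear p"
  shows "\<exists>F. linear F \<and> (\<forall>x. F x \<le> p x)"
proof -
  define A where "A = {q :: 'a \<Rightarrow> real. sublinear q \<and> q \<le> p}"
  have "\<exists>m\<in>A. \<forall>q\<in>A. q \<le> m \<longrightarrow> q = m"
  proof (rule predicate_Zorn)
    show "partial_order_on A (relation_of (\<lambda>q q' :: 'a \<Rightarrow> real. q' \<le> q) A)"
      by (rule partial_order_on_relation_ofI) auto
  next
    fix C assume "C \<in> Chains (relation_of (\<lambda>q q' :: 'a \<Rightarrow> real. q' \<le> q) A)"
    then have CA: "C \<subseteq> A" and total: "\<And>c d. c \<in> C \<Longrightarrow> d \<in> C \<Longrightarrow> c \<le> d \<or> d \<le> c"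
      by (auto simp: Chains_def relation_of_def)
    show "\<exists>u\<in>A. \<forall>c\<in>C. u \<le> c"
    proof (cases "C = {}")
      case True
      then show ?thesis using p by (auto simp: A_def)
    next
      case False
      define u where "u x = (INF c\<in>C. c x)" for x
      have subl: "sublinear c" and below: "c x \<le> p x" if "c \<in> C" for c x
        using CA that by (auto simp: A_def le_fun_def)
      have "- p (- x) \<le> c x" if "c \<in> C" for c x
        using sublinear_minus[OF subl[OF that], of x] below[OF that, of "- x"] by linarith
      then have bdd: "bdd_below ((\<lambda>c. c x) ` C)" for x
        by (intro bdd_belowI2[where m = "- p (- x)"]) auto
      have upper: "u x \<le> c x" if "c \<in> C" for c x
        unfolding u_def using cINF_lower[OF bdd that] .
      have greatest: "m \<le> u x" if "\<And>c. c \<in> C \<Longrightarrow> m \<le> c x" for m x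
        unfolding u_def using False that by (intro cINF_greatest) auto
      have "sublinear u"
      proof (rule sublinearI)
        fix x y
        have "u (x + y) - d y \<le> c x" if "c \<in> C" "d \<in> C" for c d
        proof (cases "c \<le> d")
          \<comment> \<open>Subadditivity is applied to the smaller of the two members of the chain.\<close>
          case True
          then show ?thesis
            using upper[OF that(1), of "x + y"] sublinear_add[OF subl[OF that(1)], of x y]
            by (simp add: le_fun_def) (smt (verit, best))
        next
          case False
          with total[OF that] have "d \<le> c" by blast
          then show ?thesis
            using upper[OF that(2), of "x + y"] sublinear_add[OF subl[OF that(2)], of x y]
            by (simp add: le_fun_def) (smt (verit, best))
        qed
        then have "u (x + y) - d y \<le> u x" if "d \<in> C" for d
          using that by (intro greatest)
        then have "u (x + y) - u x \<le> d y" if "d \<in> C" for d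
          using that by (simp add: algebra_simps)
        then have "u (x + y) - u x \<le> u y" by (intro greatest)
        then show "u (x + y) \<le> u x + u y" by simp
      next
        show "u 0 = 0"
          using False by (simp add: u_def sublinear_zero[OF subl] cong: INF_cong)
      next
        fix k :: real and x
        assume "0 < k"
        have "u (k *\<^sub>R x) / k \<le> c x" if "c \<in> C" for c
          using upper[OF that, of "k *\<^sub>R x"] sublinear_scale[OF subl[OF that], of k x] \<open>0 < k\<close>
          by (simp add: field_simps)
        then have "u (k *\<^sub>R x) / k \<le> u x" by (rule greatest)
        with \<open>0 < k\<close> show "u (k *\<^sub>R x) \<le> k * u x" by (simp add: field_simps)
      qed
      moreover have "u \<le> p"
        using False upper below by (fastforce simp: le_fun_def intro: order_trans)
      ultimately show ?thesis
        using upper by (intro bexI[of _ u]) (auto simp: A_def le_fun_def)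
    qed
  qed
  then obtain m where m: "sublinear m" "m \<le> p"
    and min: "\<And>q. sublinear q \<Longrightarrow> q \<le> p \<Longrightarrow> q \<le> m \<Longrightarrow> q = m"
    by (auto simp: A_def)
  have odd: "m (- x) = - m x" for x
  proof -
    have "\<exists>q. sublinear q \<and> (\<forall>y. q y \<le> m y)
        \<and> (\<forall>(k, r)\<in>(\<lambda>t. t *\<^sub>R (x, m x)) ` {0..}. q (- k) \<le> - r)"
      by (rule sublinear_below_cone[OF m(1) convex_cone_ray])
        (auto simp: sublinear_scale[OF m(1)])
    then obtain q where q: "sublinear q" "\<And>y. q y \<le> m y"
      and "\<forall>(k, r)\<in>(\<lambda>t. t *\<^sub>R (x, m x)) ` {0..}. q (- k) \<le> - r" by blast
    then have "q (- x) \<le> - m x"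
      by (auto dest!: bspec[where x = 1])
    moreover have "q = m"
      using q m(2) by (intro min) (auto simp: le_fun_def intro: order_trans)
    ultimately show ?thesis using sublinear_minus[OF m(1), of x] by simp
  qed
  have "m (x + y) = m x + m y" for x y
    using sublinear_add[OF m(1), of x y] sublinear_add[OF m(1), of "- x" "- y"]
      odd[of x] odd[of y] odd[of "x + y"] by simp
  moreover have "m (c *\<^sub>R x) = c *\<^sub>R m x" for c x
  proof (cases "0 \<le> c")
    case False
    then have "m (c *\<^sub>R x) = - m ((- c) *\<^sub>R x)"
      using odd[of "c *\<^sub>R x"] by simp
    also have "\<dots> = c * m x"
      using False sublinear_scale[OF m(1), of "- c" x] by simp
    finally show ?thesis by simp
  qed (simp add: sublinear_scale[OF m(1)])
  ultimately have "linear m" by (rule linearI)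
  with m(2) show ?thesis by (auto simp: le_fun_def)
qed

text \<open>The subspace form of Hahn--Banach is the case where \<open>G\<close> is the graph of a linear functional,
  because a graph contains \<open>(- k, - r)\<close> along with \<open>(k, r)\<close>. A cone also expresses one-sided
  demands, such as a large value at one point together with zero on a subspace.\<close>

lemma hahn_banach_cone:
  fixes p :: "'a::real_vector \<Rightarrow> real"
  assumes "sublinear p" and "convex_cone G"
    and "\<And>k r. (k, r) \<in> G \<Longrightarrow> r \<le> p k"
  shows "\<exists>F. linear F \<and> (\<forall>x. F x \<le> p x) \<and> (\<forall>(k, r)\<in>G. r \<le> F k)"
proof -
  obtain q where q: "sublinear q" "\<And>x. q x \<le> p x" "\<And>k r. (k, r) \<in> G \<Longrightarrow> q (- k) \<le> - r"
    using sublinear_below_cone[OF assms] by blast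
  obtain F where F: "linear F" "\<And>x. F x \<le> q x"
    using linear_below_sublinear[OF q(1)] by blast
  have "r \<le> F k" if "(k, r) \<in> G" for k r
    using F(2)[of "- k"] q(3)[OF that] linear_neg[OF F(1), of k] by simp
  moreover have "F x \<le> p x" for x
    using F(2) q(2) order_trans by blast
  ultimately show ?thesis using F(1) by blast
qed

section \<open>Norms of functionals\<close>

lemma blinfun_below_norm:
  fixes F :: "'a::real_normed_vector \<Rightarrow> real"
  assumes F: "linear F" "\<And>x. F x \<le> r * norm x" and "0 \<le> r"
  shows "\<exists>k :: 'a \<Rightarrow>\<^sub>L real. blinfun_apply k = F \<and> norm k \<le> r"
proof -
  have abs: "\<bar>F x\<bar> \<le> r * norm x" for x
    using F(2)[of x] F(2)[of "- x"] linear_neg[OF F(1), of x] by simp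
  have "bounded_linear F"
    by (rule bounded_linear_intro[where K = r])
      (use F(1) abs in \<open>auto simp: linear_add linear_scale mult.commute\<close>)
  then have "blinfun_apply (Blinfun F) = F" by (rule bounded_linear_Blinfun_apply)
  then show ?thesis
    using norm_blinfun_bound[OF \<open>0 \<le> r\<close>, of "Blinfun F"] abs by auto
qed

lemma norm_blinfun_le_unit_ball:
  fixes f :: "'a::real_normed_vector \<Rightarrow>\<^sub>L real"
  assumes "\<And>x. norm x \<le> 1 \<Longrightarrow> f x \<le> r"
  shows "norm f \<le> r"
proof (rule norm_blinfun_bound)
  show "0 \<le> r" using assms[of 0] by simp
  fix x
  have *: "f y \<le> r * norm y" for y
  proof (cases "y = 0")
    case False
    then show ?thesis
      using assms[of "y /\<^sub>R norm y"] by (simp add: blinfun.scaleR_right field_simps)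
  qed simp
  show "norm (f x) \<le> r * norm x"
    using *[of x] *[of "- x"] by (simp add: blinfun.minus_right)
qed

lemma blinfun_le_norm:
  fixes f :: "'a::real_normed_vector \<Rightarrow>\<^sub>L real"
  shows "norm x \<le> 1 \<Longrightarrow> f x \<le> norm f"
  using norm_blinfun[of f x] mult_left_le[of "norm x" "norm f"] by simp

lemma norm_blinfun_less_unit_ball:
  fixes f :: "'a::real_normed_vector \<Rightarrow>\<^sub>L real"
  assumes "r < norm f"
  shows "\<exists>x. norm x \<le> 1 \<and> r < f x"
  using norm_blinfun_le_unit_ball[of f r] assms by (meson not_less)

section \<open>Consequences of the L-projection\<close>

lemma L_projectionD:
  assumes "L_projection P"
  shows "linear P" and "P (P z) = P z" and "norm z = norm (P z) + norm (z - P z)"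
  using assms unfolding L_projection_def by blast+

text \<open>A Hahn--Banach extension \<open>k\<close> of the restriction of \<open>g\<close> to \<open>Y\<close> differs from \<open>g\<close> by an element of
  the kernel of \<open>P\<close>, so \<open>P k = g\<close>; and \<open>P\<close> does not increase norms. Thus functionals in the range
  of \<open>P\<close> lose no norm when restricted to \<open>Y\<close>.\<close>

lemma norm_le_of_restriction:
  fixes Y :: "'a::real_normed_vector set"
  assumes Y: "subspace Y" and P: "L_projection P" and ker: "{f. P f = 0} = annihilator Y"
    and g: "P g = g" and le: "\<And>y. y \<in> unit_ball_of Y \<Longrightarrow> blinfun_apply g y \<le> r"
  shows "norm g \<le> r"
proof -
  have r: "0 \<le> r" using le[of 0] subspace_0[OF Y] by (simp add: unit_ball_of_def)
  define G where "G = (\<lambda>y. (y, blinfun_apply g y)) ` Y"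
  have "linear (\<lambda>y. (y, blinfun_apply g y))"
    by (auto intro!: linearI simp: blinfun.add_right blinfun.scaleR_right)
  then have G: "convex_cone G"
    unfolding G_def by (intro subspace_imp_convex_cone linear_subspace_image Y)
  have bd: "g y \<le> r * norm y" if "y \<in> Y" for y
  proof (cases "y = 0")
    case False
    then show ?thesis
      using le[of "y /\<^sub>R norm y"] subspace_scale[OF Y that]
      by (simp add: blinfun.scaleR_right unit_ball_of_def field_simps)
  qed simp
  have "\<exists>F. linear F \<and> (\<forall>x. F x \<le> r * norm x) \<and> (\<forall>(k, s)\<in>G. s \<le> F k)"
    by (rule hahn_banach_cone[OF sublinear_norm[OF r] G]) (auto simp: G_def bd)
  then obtain F where F: "linear F" "\<And>x. F x \<le> r * norm x" "\<And>y. y \<in> Y \<Longrightarrow> g y \<le> F y"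
    by (auto simp: G_def)
  have eq: "F y = g y" if "y \<in> Y" for y
    using F(3)[OF that] F(3)[OF subspace_neg[OF Y that]] linear_neg[OF F(1), of y]
    by (simp add: blinfun.minus_right)
  obtain k :: "'a \<Rightarrow>\<^sub>L real" where k: "blinfun_apply k = F" "norm k \<le> r"
    using blinfun_below_norm[OF F(1,2) r] by blast
  have "k - g \<in> annihilator Y"
    by (simp add: annihilator_def blinfun.diff_left k(1) eq)
  then have "P (k - g) = 0" using ker by blast
  then have "P k = g"
    using g by (simp add: linear_diff[OF L_projectionD(1)[OF P]])
  then have "norm g \<le> norm k"
    using L_projectionD(3)[OF P, of k] norm_ge_zero[of "k - P k"] by simp
  with k(2) show ?thesis by simp
qed

text \<open>If no such \<open>z\<close> existed, the triple of the \<open>x + y\<^sub>k\<close> would be far from the diagonal copy of \<open>Y\<close> in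
  \<open>X \<times> X \<times> X\<close> with the maximum norm. A separating functional consists of \<open>F1, F2, F3\<close> whose norms
  add up to at most 1 and whose sum annihilates \<open>Y\<close>. Hence the \<open>P Fk\<close> add up to 0, and the value at
  the triple is the sum of the \<open>(Fk - P Fk) x\<close> and the \<open>P Fk yk\<close>. As \<open>P\<close> is an \<open>L\<close>-projection, this
  is at most the sum of the norms of the \<open>Fk\<close>, a contradiction.\<close>

lemma three_ball_property:
  fixes Y :: "'a::real_normed_vector set"
  assumes Y: "subspace Y" and P: "L_projection P" and ker: "{f. P f = 0} = annihilator Y"
    and x: "norm x \<le> 1"
    and y: "y1 \<in> unit_ball_of Y" "y2 \<in> unit_ball_of Y" "y3 \<in> unit_ball_of Y"
    and "0 < \<delta>"
  shows "\<exists>z\<in>Y. norm (x + y1 - z) \<le> 1 + \<delta> \<and> norm (x + y2 - z) \<le> 1 + \<delta> \<and> norm (x + y3 - z) \<le> 1 + \<delta>"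
proof (rule ccontr)
  assume contra: "\<not> ?thesis"
  define N :: "'a \<times> 'a \<times> 'a \<Rightarrow> real" where
    "N = (\<lambda>(a, b, c). max (norm a) (max (norm b) (norm c)))"
  have N: "sublinear N"
  proof (rule sublinearI)
    show "N (v + w) \<le> N v + N w" for v w
    proof -
      obtain a b c a' b' c' where "v = (a, b, c)" "w = (a', b', c')"
        by (metis prod.collapse)
      then show ?thesis
        using norm_triangle_ineq[of a a'] norm_triangle_ineq[of b b'] norm_triangle_ineq[of c c']
        by (simp add: N_def) linarith
    qed
    show "N 0 = 0" by (simp add: N_def zero_prod_def)
    show "N (t *\<^sub>R v) \<le> t * N v" if "0 < t" for t v
      using that by (auto simp: N_def max_mult_distrib_left split: prod.split)
  qed
  have N_ge0: "0 \<le> N v" for v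
    by (auto simp: N_def le_max_iff_disj split: prod.split)
  define p where "p = (x + y1, x + y2, x + y3)"
  define G where "G = {(t *\<^sub>R p - (z, z, z), t * (1 + \<delta>)) | t z. 0 \<le> t \<and> z \<in> Y}"
  have far: "1 + \<delta> \<le> N (p - (z, z, z))" if "z \<in> Y" for z
    using contra that by (auto simp: N_def p_def)
  have dom: "r \<le> N k" if kr: "(k, r) \<in> G" for k r
  proof -
    obtain t z where t: "0 \<le> t" "z \<in> Y" and k: "k = t *\<^sub>R p - (z, z, z)" and r: "r = t * (1 + \<delta>)"
      using kr by (auto simp: G_def)
    show ?thesis
    proof (cases "t = 0")
      case False
      then have "k = t *\<^sub>R (p - (z /\<^sub>R t, z /\<^sub>R t, z /\<^sub>R t))"
        by (simp add: k scaleR_diff_right)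
      then have "N k = t * N (p - (z /\<^sub>R t, z /\<^sub>R t, z /\<^sub>R t))"
        using sublinear_scale[OF N t(1)] by simp
      then show ?thesis
        using far[OF subspace_scale[OF Y t(2), of "inverse t"]] t(1) by (simp add: r mult_left_mono)
    qed (simp add: r N_ge0)
  qed
  have "convex_cone G"
    unfolding convex_cone_iff
  proof (intro conjI ballI allI impI)
    have "(0 *\<^sub>R p - (0, 0, 0), 0 * (1 + \<delta>)) \<in> G"
      unfolding G_def using subspace_0[OF Y] by blast
    then show "0 \<in> G" by (simp flip: zero_prod_def)
  next
    fix g and s :: real
    assume "g \<in> G" "0 \<le> s"
    then obtain t z where t: "0 \<le> t" "z \<in> Y" "g = (t *\<^sub>R p - (z, z, z), t * (1 + \<delta>))"
      by (auto simp: G_def)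
    have "s *\<^sub>R g = ((s * t) *\<^sub>R p - (s *\<^sub>R z, s *\<^sub>R z, s *\<^sub>R z), (s * t) * (1 + \<delta>))"
      by (simp add: t(3) scaleR_diff_right)
    then show "s *\<^sub>R g \<in> G"
      unfolding G_def using t(1,2) \<open>0 \<le> s\<close> subspace_scale[OF Y, of z s] by fastforce
  next
    fix g h assume "g \<in> G" "h \<in> G"
    obtain t z s w where t: "0 \<le> t" "z \<in> Y" "g = (t *\<^sub>R p - (z, z, z), t * (1 + \<delta>))"
      and s: "0 \<le> s" "w \<in> Y" "h = (s *\<^sub>R p - (w, w, w), s * (1 + \<delta>))"
      using \<open>g \<in> G\<close> \<open>h \<in> G\<close> by (auto simp: G_def)
    have "g + h = ((t + s) *\<^sub>R p - ((z, z, z) + (w, w, w)), (t + s) * (1 + \<delta>))"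
      by (simp add: t(3) s(3) algebra_simps del: add_Pair) (simp only: add_Pair algebra_simps)
    then show "g + h \<in> G"
      unfolding G_def using t(1,2) s(1,2) subspace_add[OF Y, of z w] by fastforce
  qed
  from hahn_banach_cone[OF N this dom] obtain F where
    F: "linear F" "\<And>v. F v \<le> N v" "\<And>k r. (k, r) \<in> G \<Longrightarrow> r \<le> F k" by blast
  \<comment> \<open>The constraints with \<open>t = 0\<close> make \<open>F\<close> vanish on the diagonal of \<open>Y\<close>; \<open>t = 1\<close>, \<open>z = 0\<close> bounds
    \<open>F p\<close> from below.\<close>
  have diag: "F (z, z, z) = 0" if "z \<in> Y" for z
  proof -
    have "0 \<le> - F (z, z, z)" if "z \<in> Y" for z
    proof -
      have "(0 *\<^sub>R p - (z, z, z), 0 * (1 + \<delta>)) \<in> G" unfolding G_def using that by blast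
      from F(3)[OF this] show ?thesis using linear_neg[OF F(1), of "(z, z, z)"] by simp
    qed
    from this[OF that] this[OF subspace_neg[OF Y that]] show ?thesis
      using linear_neg[OF F(1), of "(z, z, z)"] by simp
  qed
  have "(1 *\<^sub>R p - (0, 0, 0), 1 * (1 + \<delta>)) \<in> G"
    unfolding G_def using subspace_0[OF Y] zero_le_one by blast
  from F(3)[OF this] have Fp: "1 + \<delta> \<le> F p" by (simp flip: zero_prod_def)
  have "linear (\<lambda>a. F (a, 0, 0))" "linear (\<lambda>a. F (0, a, 0))" "linear (\<lambda>a. F (0, 0, a))"
    using linear_scale[OF F(1), of _ "(_, 0, 0)"] linear_scale[OF F(1), of _ "(0, _, 0)"]
      linear_scale[OF F(1), of _ "(0, 0, _)"]
    by (auto intro!: linearI simp flip: linear_add[OF F(1)])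
  moreover have "F (a, 0, 0) \<le> 1 * norm a" "F (0, a, 0) \<le> 1 * norm a" "F (0, 0, a) \<le> 1 * norm a" for a
    using F(2)[of "(a, 0, 0)"] F(2)[of "(0, a, 0)"] F(2)[of "(0, 0, a)"] by (auto simp: N_def)
  ultimately obtain F1 F2 F3 :: "'a \<Rightarrow>\<^sub>L real" where
    Fk: "blinfun_apply F1 = (\<lambda>a. F (a, 0, 0))" "blinfun_apply F2 = (\<lambda>a. F (0, a, 0))"
      "blinfun_apply F3 = (\<lambda>a. F (0, 0, a))"
    using blinfun_below_norm[where r = 1] by (metis zero_le_one)
  have split: "F (a, b, c) = F1 a + F2 b + F3 c" for a b c
    by (simp add: Fk flip: linear_add[OF F(1)])
  \<comment> \<open>The dual of a maximum norm is a sum of norms: take the supremum over one variable at a time.\<close>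
  have "norm F1 + norm F2 + norm F3 \<le> 1"
  proof -
    have "F1 a \<le> 1 - F2 b - F3 c" if "norm a \<le> 1" "norm b \<le> 1" "norm c \<le> 1" for a b c
      using F(2)[of "(a, b, c)"] that by (simp add: split N_def)
    then have "norm F1 \<le> 1 - F2 b - F3 c" if "norm b \<le> 1" "norm c \<le> 1" for b c
      using that by (intro norm_blinfun_le_unit_ball)
    then have "F2 b \<le> 1 - norm F1 - F3 c" if "norm b \<le> 1" "norm c \<le> 1" for b c
      using that by (simp add: algebra_simps)
    then have "norm F2 \<le> 1 - norm F1 - F3 c" if "norm c \<le> 1" for c
      using that by (intro norm_blinfun_le_unit_ball)
    then have "F3 c \<le> 1 - norm F1 - norm F2" if "norm c \<le> 1" for c
      using that by (simp add: algebra_simps)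
    then have "norm F3 \<le> 1 - norm F1 - norm F2"
      by (intro norm_blinfun_le_unit_ball)
    then show ?thesis by simp
  qed
  note linP = L_projectionD(1)[OF P] and idem = L_projectionD(2)[OF P]
  have ann: "blinfun_apply (f - P f) z = 0" if "z \<in> Y" for f z
  proof -
    have "P (f - P f) = 0" by (simp add: linear_diff[OF linP] idem)
    then show ?thesis using ker that by (auto simp: annihilator_def)
  qed
  have "F1 + F2 + F3 \<in> annihilator Y"
    using diag split by (simp add: annihilator_def blinfun.add_left)
  then have "P F1 + P F2 + P F3 = 0"
    using ker by (simp add: linear_add[OF linP, symmetric]) blast
  then have "blinfun_apply (P F1 + P F2 + P F3) x = 0" by simp
  then have Px: "P F1 x + P F2 x + P F3 x = 0" by (simp add: blinfun.add_left)
  have *: "f (x + y) \<le> norm f + P f x" if "y \<in> unit_ball_of Y" for f :: "'a \<Rightarrow>\<^sub>L real" and y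
  proof -
    have "f (x + y) = (f - P f) x + P f y + P f x"
      using ann[of y f] that
      by (simp add: blinfun.add_right blinfun.diff_left unit_ball_of_def)
    also have "\<dots> \<le> norm (f - P f) + norm (P f) + P f x"
      using blinfun_le_norm[OF x, of "f - P f"] blinfun_le_norm[of y "P f"] that
      by (simp add: unit_ball_of_def)
    finally show ?thesis using L_projectionD(3)[OF P, of f] by simp
  qed
  have "F p \<le> norm F1 + norm F2 + norm F3"
    unfolding p_def split using *[OF y(1), of F1] *[OF y(2), of F2] *[OF y(3), of F3] Px by linarith
  with Fp \<open>norm F1 + norm F2 + norm F3 \<le> 1\<close> \<open>0 < \<delta>\<close> show False by simp
qed

section \<open>Slices\<close>

lemma is_slice_of_norming:
  fixes Y :: "'a::real_normed_vector set" and f :: "'a \<Rightarrow>\<^sub>L real"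
  assumes Y: "subspace Y" and f: "norm f \<le> 1" and "0 < \<alpha>"
    and norming: "\<And>r. r < 1 \<Longrightarrow> \<exists>y\<in>unit_ball_of Y. r < blinfun_apply f y"
  shows "is_slice Y {y \<in> unit_ball_of Y. 1 - \<alpha> < f y}"
proof -
  have abs: "\<bar>f y\<bar> \<le> 1" if "y \<in> unit_ball_of Y" for y
    using blinfun_le_norm[of y f] blinfun_le_norm[of "- y" f] that f
    by (simp add: unit_ball_of_def blinfun.minus_right)
  have le: "f y \<le> 1" if "y \<in> unit_ball_of Y" for y
    using abs[OF that] by simp
  have ne: "unit_ball_of Y \<noteq> {}" using norming[of 0] by auto
  have "Sup (f ` unit_ball_of Y) = 1"
  proof (rule cSup_eq_non_empty)
    fix u assume "\<And>v. v \<in> f ` unit_ball_of Y \<Longrightarrow> v \<le> u"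
    then show "1 \<le> u" using norming[of u] by (force simp: not_less)
  qed (use ne le in auto)
  moreover have "dual_norm_on Y f = 1"
    unfolding dual_norm_on_def
  proof (rule cSup_eq_non_empty)
    fix u assume u: "\<And>v. v \<in> (\<lambda>y. \<bar>blinfun_apply f y\<bar>) ` unit_ball_of Y \<Longrightarrow> v \<le> u"
    show "1 \<le> u"
    proof (rule ccontr)
      assume "\<not> 1 \<le> u"
      then obtain y where "y \<in> unit_ball_of Y" "u < f y" using norming[of u] by auto
      with u[of "\<bar>f y\<bar>"] show False by auto
    qed
  qed (use ne abs in auto)
  moreover have "blinfun_apply f \<in> dual_on Y"
    using norm_blinfun[of f]
    by (auto simp: dual_on_def blinfun.add_right blinfun.scaleR_right)
  ultimately show ?thesis
    unfolding is_slice_def slice_def using \<open>0 < \<alpha>\<close> by (intro exI[of _ "blinfun_apply f"] exI[of _ \<alpha>]) simp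
qed

lemma is_slice_UNIV_E:
  fixes S :: "'a::real_normed_vector set"
  assumes "is_slice UNIV S"
  obtains f :: "'a \<Rightarrow>\<^sub>L real" and \<alpha> where "norm f = 1" "0 < \<alpha>" "\<And>x. norm x \<le> 1 \<Longrightarrow> 1 - \<alpha> < f x \<Longrightarrow> x \<in> S"
proof -
  obtain \<phi> \<alpha> where \<phi>: "bounded_linear \<phi>" "onorm \<phi> = 1" "0 < \<alpha>" "S = slice UNIV \<phi> \<alpha>"
    using assms by (auto simp: is_slice_def dual_on_UNIV dual_norm_on_UNIV)
  define f where "f = Blinfun \<phi>"
  have f: "blinfun_apply f = \<phi>" using \<phi>(1) by (simp add: f_def bounded_linear_Blinfun_apply)
  have n: "norm f = 1" using \<phi>(2) by (simp add: norm_blinfun.rep_eq f)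
  have "Sup (f ` unit_ball_of UNIV) \<le> 1"
  proof (rule cSup_least)
    show "blinfun_apply f ` unit_ball_of UNIV \<noteq> {}" by (auto simp: unit_ball_of_def intro: exI[of _ 0])
  qed (use blinfun_le_norm[of _ f] n in \<open>auto simp: unit_ball_of_def\<close>)
  then have "x \<in> S" if "norm x \<le> 1" "1 - \<alpha> < f x" for x
    using that by (simp add: \<phi>(4) slice_def unit_ball_of_def f)
  with n \<phi>(3) show ?thesis by (rule that)
qed

text \<open>This supplies slices of the ball of \<open>Y\<close> when the functional \<open>P f\<close> is zero.\<close>

lemma exists_norming_functional:
  fixes y :: "'a::real_normed_vector"
  shows "\<exists>f :: 'a \<Rightarrow>\<^sub>L real. norm f \<le> 1 \<and> norm y \<le> blinfun_apply f y"
proof -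
  have "\<exists>F. linear F \<and> (\<forall>x. F x \<le> 1 * norm x) \<and> (\<forall>(k, r)\<in>(\<lambda>t. t *\<^sub>R (y, norm y)) ` {0..}. r \<le> F k)"
    by (rule hahn_banach_cone[OF sublinear_norm convex_cone_ray]) auto
  then obtain F where F: "linear F" "\<And>x. F x \<le> 1 * norm x"
    and "\<forall>(k, r)\<in>(\<lambda>t. t *\<^sub>R (y, norm y)) ` {0..}. r \<le> F k" by blast
  then have "norm y \<le> F y" by (auto dest!: bspec[where x = 1])
  with blinfun_below_norm[OF F] show ?thesis by auto
qed

text \<open>Diameters only see differences: the vector \<open>v\<close> added to \<open>y\<close> and \<open>y'\<close> to reach \<open>S\<close>
  depends on the pair, but is the same for both members, so it cancels from the difference. The
  error comes only from rescaling to the unit ball.\<close>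

lemma M_ideal_slice_lift:
  fixes Y :: "'a::real_normed_vector set"
  assumes Y: "subspace Y" "Y \<noteq> {0}"
    and P: "L_projection P" and ker: "{f. P f = 0} = annihilator Y"
    and S: "is_slice UNIV S" and "0 < \<eta>"
  shows "\<exists>T. is_slice Y T \<and>
    (\<forall>y\<in>T. \<forall>y'\<in>T. \<exists>u\<in>S. \<exists>u'\<in>S. norm ((y - y') - (u - u')) \<le> \<eta>)"
proof -
  obtain f :: "'a \<Rightarrow>\<^sub>L real" and \<alpha> where f: "norm f = 1" and \<alpha>: "0 < \<alpha>"
    and inS: "\<And>x. norm x \<le> 1 \<Longrightarrow> 1 - \<alpha> < f x \<Longrightarrow> x \<in> S"
    using is_slice_UNIV_E[OF S] by blast
  define g where "g = P f"
  define h where "h = f - g"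
  have Pg: "P g = g" by (simp add: g_def L_projectionD(2)[OF P])
  have sum1: "norm g + norm h = 1"
    using L_projectionD(3)[OF P, of f] f by (simp add: g_def h_def)
  have fgh: "f v = g v + h v" for v by (simp add: h_def blinfun.diff_left)
  have "P h = 0"
    using Pg by (simp add: h_def linear_diff[OF L_projectionD(1)[OF P]] flip: g_def)
  then have hY: "h z = 0" if "z \<in> Y" for z
    using ker that by (auto simp: annihilator_def)
  \<comment> \<open>The estimates below lose \<open>5 * \<delta>\<close> in the value of \<open>f\<close>, rescaling loses another \<open>\<delta>\<close>, and the
    rescaling moves a difference of two vectors in the ball by at most \<open>2 * \<delta>\<close>.\<close>
  define \<delta> where "\<delta> = min (\<alpha> / 6) (\<eta> / 2)"
  have \<delta>: "0 < \<delta>" "6 * \<delta> \<le> \<alpha>" "2 * \<delta> \<le> \<eta>" using \<alpha> \<open>0 < \<eta>\<close> by (auto simp: \<delta>_def)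
  obtain T where T: "is_slice Y T" and TY: "T \<subseteq> unit_ball_of Y"
    and Tg: "\<And>y. y \<in> T \<Longrightarrow> norm g - \<delta> < g y"
  proof (cases "g = 0")
    \<comment> \<open>Here the lower bound on \<open>g\<close> holds everywhere, so any slice will do.\<close>
    case True
    obtain y0 where y0: "y0 \<in> Y" "y0 \<noteq> 0" using Y subspace_0[OF Y(1)] by blast
    define y1 where "y1 = y0 /\<^sub>R norm y0"
    have y1: "y1 \<in> Y" "norm y1 = 1" using y0 subspace_scale[OF Y(1)] by (auto simp: y1_def)
    obtain \<phi> :: "'a \<Rightarrow>\<^sub>L real" where \<phi>: "norm \<phi> \<le> 1" "norm y1 \<le> \<phi> y1"
      using exists_norming_functional by blast
    have "is_slice Y {y \<in> unit_ball_of Y. 1 - 1 < \<phi> y}"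
      by (rule is_slice_of_norming[OF Y(1) \<phi>(1)])
        (use y1 \<phi>(2) in \<open>auto simp: unit_ball_of_def intro!: bexI[of _ y1]\<close>)
    then show ?thesis by (rule that) (use True \<delta> in auto)
  next
    case False
    then have ng: "0 < norm g" by simp
    have "is_slice Y {y \<in> unit_ball_of Y. 1 - \<delta> < blinfun_apply (g /\<^sub>R norm g) y}"
    proof (rule is_slice_of_norming[OF Y(1) _ \<delta>(1)])
      show "\<exists>y\<in>unit_ball_of Y. r < blinfun_apply (g /\<^sub>R norm g) y" if "r < 1" for r
      proof -
        have "\<not> norm g \<le> r * norm g" using that ng by simp
        then obtain y where "y \<in> unit_ball_of Y" "r * norm g < g y"
          using norm_le_of_restriction[OF Y(1) P ker Pg] by (meson not_less)
        then show ?thesis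
          using ng by (intro bexI[of _ y]) (auto simp: blinfun.scaleR_left field_simps)
      qed
    qed (use ng in simp)
    then show ?thesis
    proof (rule that)
      fix y assume "y \<in> {y \<in> unit_ball_of Y. 1 - \<delta> < blinfun_apply (g /\<^sub>R norm g) y}"
      then have "norm g - norm g * \<delta> < g y"
        using ng by (simp add: blinfun.scaleR_left field_simps)
      moreover have "norm g * \<delta> \<le> \<delta>"
        using sum1 \<delta>(1) norm_ge_zero[of h] norm_ge_zero[of g]
        by (intro mult_left_le_one_le) linarith+
      ultimately show "norm g - \<delta> < g y" by simp
    qed auto
  qed
  obtain x where x: "norm x \<le> 1" "norm h - \<delta> < h x"
    using norm_blinfun_less_unit_ball[of "norm h - \<delta>" h] \<delta>(1) by auto
  have "\<exists>u\<in>S. \<exists>u'\<in>S. norm ((y - y') - (u - u')) \<le> \<eta>" if yT: "y \<in> T" "y' \<in> T" for y y'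
  proof -
    have y: "y \<in> unit_ball_of Y" "y' \<in> unit_ball_of Y" "- y \<in> unit_ball_of Y"
      using yT TY subspace_neg[OF Y(1)] by (auto simp: unit_ball_of_def)
    have yY: "y \<in> Y" "y' \<in> Y" using y by (auto simp: unit_ball_of_def)
    obtain z where z: "z \<in> Y" and "norm (x + y - z) \<le> 1 + \<delta>" "norm (x + y' - z) \<le> 1 + \<delta>"
      "norm (x + - y - z) \<le> 1 + \<delta>"
      using three_ball_property[OF Y(1) P ker x(1) y \<delta>(1)] by blast
    moreover define v where "v = x - z"
    ultimately have v: "norm (y + v) \<le> 1 + \<delta>" "norm (y' + v) \<le> 1 + \<delta>" "norm (v - y) \<le> 1 + \<delta>"
      by (simp_all add: add.commute add_diff_eq diff_diff_eq)
    have hv: "norm h - \<delta> < h v" using x(2) hY[OF z] by (simp add: v_def blinfun.diff_right)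
    \<comment> \<open>The functional \<open>h - g\<close> has norm at most 1, and \<open>(h - g) (v - y) = h v + g y - g v\<close>.\<close>
    have "(h - g) (v - y) \<le> 1 + \<delta>"
    proof -
      have "(h - g) (v - y) \<le> norm (h - g) * norm (v - y)"
        using norm_blinfun[of "h - g" "v - y"] by simp
      also have "\<dots> \<le> 1 * (1 + \<delta>)"
        using v(3) sum1 norm_triangle_ineq4[of h g] by (intro mult_mono) auto
      finally show ?thesis by simp
    qed
    then have gv: "- 3 * \<delta> < g v"
      using hv Tg[OF yT(1)] hY[OF yY(1)] sum1
      by (simp add: blinfun.diff_left blinfun.diff_right)
    have mem: "(w + v) /\<^sub>R (1 + \<delta>) \<in> S" if "w \<in> T" "norm (w + v) \<le> 1 + \<delta>" for w
    proof (rule inS)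
      show "norm ((w + v) /\<^sub>R (1 + \<delta>)) \<le> 1" using that(2) \<delta>(1) by (simp add: divide_inverse_commute[symmetric])
      have "w \<in> Y" using that(1) TY by (auto simp: unit_ball_of_def)
      then have "1 - 5 * \<delta> < f (w + v)"
        using Tg[OF that(1)] hv gv sum1 hY by (simp add: fgh blinfun.add_right)
      moreover have "(1 - 6 * \<delta>) * (1 + \<delta>) \<le> 1 - 5 * \<delta>" by (simp add: algebra_simps)
      ultimately have "(1 - 6 * \<delta>) * (1 + \<delta>) < f (w + v)" by linarith
      then have "1 - 6 * \<delta> < f (w + v) / (1 + \<delta>)"
        using \<delta>(1) by (simp add: pos_less_divide_eq)
      then have "1 - 6 * \<delta> < f ((w + v) /\<^sub>R (1 + \<delta>))"
        by (simp add: blinfun.scaleR_right divide_inverse_commute)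
      then show "1 - \<alpha> < f ((w + v) /\<^sub>R (1 + \<delta>))" using \<delta>(2) by simp
    qed
    have "(y - y') - ((y + v) /\<^sub>R (1 + \<delta>) - (y' + v) /\<^sub>R (1 + \<delta>)) = (\<delta> / (1 + \<delta>)) *\<^sub>R (y - y')"
    proof -
      have "\<delta> / (1 + \<delta>) = 1 - inverse (1 + \<delta>)" using \<delta>(1) by (simp add: field_simps)
      then show ?thesis by (simp only: scaleR_diff_left) (simp add: algebra_simps)
    qed
    also have "norm \<dots> \<le> \<delta> * 2"
    proof -
      have "\<delta> / (1 + \<delta>) \<le> \<delta>" using \<delta>(1) by (simp add: field_simps)
      moreover have "norm (y - y') \<le> 2"
        using norm_triangle_ineq4[of y y'] y by (simp add: unit_ball_of_def)
      ultimately show ?thesis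
        using mult_mono[of "\<delta> / (1 + \<delta>)" \<delta> "norm (y - y')" 2] \<delta>(1) by simp
    qed
    finally have "norm ((y - y') - ((y + v) /\<^sub>R (1 + \<delta>) - (y' + v) /\<^sub>R (1 + \<delta>))) \<le> \<eta>"
      using \<delta>(3) by simp
    with mem[OF yT(1) v(1)] mem[OF yT(2) v(2)] show ?thesis by blast
  qed
  with T show ?thesis by blast
qed

section \<open>Small combinations of slices pass to M-ideals\<close>

theorem proposition2p2:
  fixes Y :: "'a::banach set"
  assumes "Y \<noteq> {0}"
    and "M_ideal Y"
    and "BSCSP (UNIV :: 'a set)"
  shows "BSCSP Y"
  unfolding BSCSP_def
proof (intro allI impI)
  fix \<epsilon> :: real
  assume "0 < \<epsilon>"
  obtain P where Y: "subspace Y" and P: "L_projection P" and ker: "{f. P f = 0} = annihilator Y"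
    using assms(2) unfolding M_ideal_def by blast
  obtain C :: "'a set" where "is_convex_combination_of_slices UNIV C" and diam: "diameter C < \<epsilon>"
    using assms(3) \<open>0 < \<epsilon>\<close> unfolding BSCSP_def by blast
  then obtain n :: nat and w :: "nat \<Rightarrow> real" and S :: "nat \<Rightarrow> 'a set" where
    S: "\<And>i. i < n \<Longrightarrow> is_slice UNIV (S i)" and w: "\<And>i. i < n \<Longrightarrow> 0 < w i" "(\<Sum>i<n. w i) = 1"
    and C: "C = {(\<Sum>i<n. w i *\<^sub>R x i) | x. \<forall>i<n. x i \<in> S i}"
    unfolding is_convex_combination_of_slices_def by blast
  define \<eta> where "\<eta> = (\<epsilon> - diameter C) / 2"
  have \<eta>: "0 < \<eta>" using diam by (simp add: \<eta>_def)
  obtain T where T: "\<And>i. i < n \<Longrightarrow> is_slice Y (T i)"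
    and lift: "\<And>i y y'. i < n \<Longrightarrow> y \<in> T i \<Longrightarrow> y' \<in> T i \<Longrightarrow>
      \<exists>u\<in>S i. \<exists>u'\<in>S i. norm ((y - y') - (u - u')) \<le> \<eta>"
    using M_ideal_slice_lift[OF Y assms(1) P ker S \<eta>] by metis
  define D where "D = {(\<Sum>i<n. w i *\<^sub>R y i) | y. \<forall>i<n. y i \<in> T i}"
  have "bounded C"
  proof (rule boundedI)
    fix c assume "c \<in> C"
    then obtain x where c: "c = (\<Sum>i<n. w i *\<^sub>R x i)" and x: "\<And>i. i < n \<Longrightarrow> x i \<in> S i"
      by (auto simp: C)
    have "norm (w i *\<^sub>R x i) \<le> w i" if "i < n" for i
      using S[OF that] x[OF that] w(1)[OF that]
      by (auto simp: is_slice_def slice_def unit_ball_of_def mult_left_le)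
    then have "norm c \<le> (\<Sum>i<n. w i)" unfolding c by (intro sum_norm_le) auto
    then show "norm c \<le> 1" using w(2) by simp
  qed
  have close: "norm (a - b) \<le> diameter C + \<eta>" if ab: "a \<in> D" "b \<in> D" for a b
  proof -
    obtain y y' where a: "a = (\<Sum>i<n. w i *\<^sub>R y i)" and b: "b = (\<Sum>i<n. w i *\<^sub>R y' i)"
      and y: "\<And>i. i < n \<Longrightarrow> y i \<in> T i" "\<And>i. i < n \<Longrightarrow> y' i \<in> T i"
      using ab by (auto simp: D_def)
    obtain u u' where u: "\<And>i. i < n \<Longrightarrow> u i \<in> S i" "\<And>i. i < n \<Longrightarrow> u' i \<in> S i"
      and near: "\<And>i. i < n \<Longrightarrow> norm ((y i - y' i) - (u i - u' i)) \<le> \<eta>"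
      using lift[OF _ y] by metis
    define c c' where "c = (\<Sum>i<n. w i *\<^sub>R u i)" and "c' = (\<Sum>i<n. w i *\<^sub>R u' i)"
    have "c \<in> C" "c' \<in> C" using u by (auto simp: C c_def c'_def)
    then have cc: "norm (c - c') \<le> diameter C"
      using diameter_bounded_bound[OF \<open>bounded C\<close>] by (simp add: dist_norm)
    have "(a - b) - (c - c') = (\<Sum>i<n. w i *\<^sub>R ((y i - y' i) - (u i - u' i)))"
      by (simp add: a b c_def c'_def sum_subtractf scaleR_diff_right)
    also have "norm \<dots> \<le> (\<Sum>i<n. w i * \<eta>)"
      using w(1) near by (intro sum_norm_le) (auto intro!: mult_left_mono simp: less_imp_le)
    also have "\<dots> = \<eta>" using w(2) by (simp flip: sum_distrib_right)
    finally show ?thesis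
      using cc norm_triangle_ineq[of "(a - b) - (c - c')" "c - c'"] by simp
  qed
  have "0 \<le> diameter C + \<eta>"
    using diameter_ge_0[OF \<open>bounded C\<close>] \<eta> by simp
  then have "diameter D \<le> diameter C + \<eta>"
    using close by (intro diameter_le) auto
  also have "\<dots> < \<epsilon>" using diam by (simp add: \<eta>_def field_simps)
  finally have "diameter D < \<epsilon>" .
  moreover have "is_convex_combination_of_slices Y D"
    unfolding is_convex_combination_of_slices_def D_def using T w by blast
  ultimately show "\<exists>C. is_convex_combination_of_slices Y C \<and> diameter C < \<epsilon>" by blast
qed

end
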